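(* Let $N \geq 1$ and let $G$ be a graph on $N$ vertices. Suppose the edges of $G$ are covered by $N$ pairwise edge-disjoint cliques of $G$ having $V_1, V_2, \ldots, V_N$ vertices respectively. Then $$\sum_{i=1}^{N} V_i \;\leq\; B(N) := N\, f^{-1}(N-1),$$ where $f(M) = M(M-1)$ and $f^{-1}$ denotes the inverse of $f$ restricted to $[1,\infty)$.
   Context: A clique of $G$ is a complete subgraph of $G$ with at least one vertex. Edge-disjoint means no edge of $G$ lies in two of the cliques; the cliques cover the edges of $G$ means every edge of $G$ lies in (exactly) one of them. The function $f(M)=M(M-1)$ is a strictly increasing bijection from $[1,\infty)$ onto $[0,\infty)$, so $f^{-1}(N-1)$ is the unique $M \ge 1$ with $M(M-1)=N-1$. *)

theory Defs
  imports Complex_Main "HOL-Library.Disjoint_Sets" "Graph_Theory.Kuratowski"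
begin

text \<open>
  Finite simple undirected graphs are those satisfying \<open>graph\<close> of the \<open>Graph_Theory\<close> library:
  finite loop-free symmetric digraphs without parallel arcs. An edge is thus a pair of opposite
  arcs. A clique, being itself a \<open>graph\<close>, contains both arcs of an edge or neither, so disjointness
  and covering of edges may be stated in terms of arcs.
\<close>

definition clique_of :: "('a, 'b) pre_digraph \<Rightarrow> ('a, 'b) pre_digraph \<Rightarrow> bool" where
  "clique_of C G \<longleftrightarrow> subgraph C G \<and> verts C \<noteq> {} \<and> complete_digraph (card (verts C)) C"

definition pronic :: "real \<Rightarrow> real" where
  "pronic M = M * (M - 1)"

lemma strict_mono_on_pronic: "strict_mono_on {1..} pronic"
  unfolding strict_mono_on_def pronic_def by (auto intro!: mult_strict_mono)

lemma bij_betw_pronic: "bij_betw pronic {1..} {0..}"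
  unfolding bij_betw_def
proof
  show "inj_on pronic {1..}"
    using strict_mono_on_pronic by (rule strict_mono_on_imp_inj_on)
  have "\<exists>x\<in>{1..}. y = pronic x" if "y \<ge> 0" for y
  proof
    let ?s = "sqrt (1 + 4 * y)"
    have "?s\<^sup>2 = 1 + 4 * y" using that by simp
    then show "y = pronic ((1 + ?s) / 2)"
      by (simp add: pronic_def field_simps power2_eq_square)
    show "(1 + ?s) / 2 \<in> {1..}" using that by simp
  qed
  then show "pronic ` {1..} = {0..}" by (auto simp: pronic_def)
qed

definition clique_bound :: "nat \<Rightarrow> real" where
  "clique_bound N = real N * the_inv_into {1..} pronic (real N - 1)"

end

theory Submission
  imports Defs
begin

text \<open>
  Let \<open>M \<ge> 1\<close> satisfy \<open>pronic M = N - 1\<close>. A clique on \<open>V\<close> vertices has \<open>pronic V\<close> arcs, so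
  arc-disjointness gives \<open>\<Sum>i. pronic (V i) \<le> N * (N - 1) = N * pronic M\<close>.
  As \<open>pronic\<close> is convex, it lies above its tangent at \<open>M\<close>, of positive slope \<open>2 * M - 1\<close>; summing
  the tangent inequality over the cliques gives \<open>\<Sum>i. V i \<le> N * M\<close>.
\<close>

lemma card_offdiag:
  assumes "finite V"
  shows "card {(u, v). (u, v) \<in> V \<times> V \<and> u \<noteq> v} = card V * (card V - 1)"
proof -
  have "{(u, v). (u, v) \<in> V \<times> V \<and> u \<noteq> v} = (SIGMA u:V. V - {u})" by auto
  then show ?thesis using assms by simp
qed

lemma (in nomulti_digraph) card_arcs_eq_card_arcs_ends:
  "card (arcs G) = card (arcs_ends G)"
  unfolding arcs_ends_def by (simp add: card_image inj_on_arc_to_ends)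

text \<open>Without loops or parallel arcs, \<open>arc_to_ends\<close> embeds the arcs into the
  off-diagonal pairs of vertices.\<close>

lemma (in digraph) card_arcs_le:
  "card (arcs G) \<le> card (verts G) * (card (verts G) - 1)"
proof -
  have "arcs_ends G \<subseteq> {(u, v). (u, v) \<in> verts G \<times> verts G \<and> u \<noteq> v}"
    by (auto simp: arcs_ends_def arc_to_ends_def dest: no_loops)
  moreover have "finite {(u, v). (u, v) \<in> verts G \<times> verts G \<and> u \<noteq> v}"
    by (rule finite_subset[of _ "verts G \<times> verts G"]) auto
  ultimately show ?thesis
    unfolding card_arcs_eq_card_arcs_ends card_offdiag[OF finite_verts, symmetric]
    by (intro card_mono)
qed

text \<open>\<open>complete_digraph\<close> prescribes only the end pairs; the count passes to the
  arcs because a \<open>graph\<close> has no parallel ones.\<close>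

lemma card_arcs_complete_digraph:
  assumes "complete_digraph n G"
  shows "card (arcs G) = n * (n - 1)"
proof -
  interpret graph G using assms by (simp add: complete_digraph_def)
  show ?thesis
    using assms card_offdiag[OF finite_verts]
    by (simp add: card_arcs_eq_card_arcs_ends complete_digraph_def)
qed

lemma pronic_of_nat: "pronic (real n) = real (n * (n - 1))"
  \<comment> \<open>Truncated subtraction matters only at \<open>n = 0\<close>, where both sides
    vanish.\<close>
  by (cases n) (auto simp: pronic_def algebra_simps)

lemma pronic_ge_tangent: "pronic M + (2 * M - 1) * (x - M) \<le> pronic x"
  \<comment> \<open>The two sides differ by exactly the square of \<open>x - M\<close>.\<close>
  using zero_le_square[of "x - M"] by (simp add: pronic_def algebra_simps)

lemma sum_le_of_sum_pronic_le:
  fixes V :: "'i \<Rightarrow> real"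
  assumes "M \<ge> 1" and "(\<Sum>i\<in>I. pronic (V i)) \<le> real (card I) * pronic M"
  shows "(\<Sum>i\<in>I. V i) \<le> real (card I) * M"
proof -
  have "(\<Sum>i\<in>I. pronic M + (2 * M - 1) * (V i - M)) \<le> (\<Sum>i\<in>I. pronic (V i))"
    by (intro sum_mono pronic_ge_tangent)
  \<comment> \<open>The constant terms sum to \<open>real (card I) * pronic M\<close> and cancel
    against the hypothesis.\<close>
  then have "(2 * M - 1) * ((\<Sum>i\<in>I. V i) - real (card I) * M) \<le> 0"
    using assms(2) by (simp add: sum.distrib sum_subtractf flip: sum_distrib_left)
  then show ?thesis using \<open>M \<ge> 1\<close> by (simp add: mult_le_0_iff)
qed

theorem theorem1:
  fixes G :: "('a, 'b) pre_digraph"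
    and C :: "nat \<Rightarrow> ('a, 'b) pre_digraph"
    and N :: nat
  assumes "N \<ge> 1"
    and "graph G"
    and "card (verts G) = N"
    and "\<And>i. i \<in> {1..N} \<Longrightarrow> clique_of (C i) G"
    and "disjoint_family_on (\<lambda>i. arcs (C i)) {1..N}"
    and "arcs G \<subseteq> (\<Union>i\<in>{1..N}. arcs (C i))"
  shows "(\<Sum>i=1..N. real (card (verts (C i)))) \<le> clique_bound N"
proof -
  interpret graph G by fact
  define M where "M = the_inv_into {1..} pronic (real N - 1)"
  \<comment> \<open>Membership in the range makes \<open>the_inv_into\<close> a true inverse here,
    not an unspecified value.\<close>
  have N_mem: "real N - 1 \<in> pronic ` {1..}"
    using bij_betw_pronic \<open>N \<ge> 1\<close> by (simp add: bij_betw_def)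
  have inj: "inj_on pronic {1..}"
    using bij_betw_pronic by (simp add: bij_betw_def)
  have "M \<ge> 1"
    using the_inv_into_into[OF inj N_mem order.refl] by (simp add: M_def)
  have pronic_M: "pronic M = real N - 1"
    unfolding M_def by (rule f_the_inv_into_f[OF inj N_mem])
  have sub: "arcs (C i) \<subseteq> arcs G" if "i \<in> {1..N}" for i
    using assms(4)[OF that] by (auto simp: clique_of_def subgraph_def)
  have arcs_clique: "card (arcs (C i)) = card (verts (C i)) * (card (verts (C i)) - 1)"
    if "i \<in> {1..N}" for i
    using assms(4)[OF that] by (intro card_arcs_complete_digraph) (simp add: clique_of_def)
  have "(\<Sum>i=1..N. card (verts (C i)) * (card (verts (C i)) - 1)) = (\<Sum>i=1..N. card (arcs (C i)))"
    using arcs_clique by simp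
  also have "\<dots> = card (\<Union>i\<in>{1..N}. arcs (C i))"
    using assms(5) sub finite_subset[OF sub finite_arcs]
    by (intro card_UN_disjoint[symmetric]) (auto simp: disjoint_family_on_def)
  also have "\<dots> \<le> card (arcs G)"
    using sub by (intro card_mono finite_arcs UN_least)
  also have "\<dots> \<le> N * (N - 1)"
    using card_arcs_le assms(3) by simp
  finally have "(\<Sum>i=1..N. pronic (real (card (verts (C i))))) \<le> real (N * (N - 1))"
    unfolding pronic_of_nat by (simp only: of_nat_le_iff flip: of_nat_sum)
  \<comment> \<open>As \<open>N \<ge> 1\<close>, the natural number \<open>N - 1\<close> casts to
    \<open>real N - 1\<close>, which is \<open>pronic M\<close>.\<close>
  then have "(\<Sum>i=1..N. pronic (real (card (verts (C i))))) \<le> real (card {1..N}) * pronic M"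
    using \<open>N \<ge> 1\<close> by (simp add: pronic_M of_nat_diff)
  from sum_le_of_sum_pronic_le[OF \<open>M \<ge> 1\<close> this] show ?thesis
    by (simp add: clique_bound_def M_def)
qed

end
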